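(* Let $G_4$ be the graph on the twelve vertices $o,1,2,3,v_0,\dots,v_7$ with edges $o1,o2,o3$; $1v_0,1v_3,1v_6$; $2v_1,2v_4,2v_7$; $3v_2,3v_5$; and $e_i=v_{i-1}v_i$ for $1\le i\le7$. Let $B_0$ be the breadth-first spanning tree from $o$, consisting of all edges except $e_1,\dots,e_7$, so that $R=\{e_1,\dots,e_7\}$. Then the full stratum $\sigma=R$ is dead with $h(K_\sigma)=(1,3,4)$, and it is obstructed for every choice of fibres at the dead strata strictly inside it. Consequently $(M(G_4),B_0)$ does not carry a fibre system.
   Context: $M=M(G_4)$ is the graphic matroid on the edge set $E$, with basis $B_0$ and $R=E\setminus B_0$. For $i\in R$, $C_i$ is the fundamental circuit, the unique circuit in $B_0\cup\{i\}$. For $\sigma\subseteq R$ put $m_\sigma(e)=\#\{i\in\sigma:e\in C_i\}$, $U_\sigma=\{e:m_\sigma(e)=1\}$, $A_\sigma=\{e:m_\sigma(e)\ge1\}$. A stratum is a nonempty $\sigma\subseteq R$; it is dead if $U_\sigma$ is independent in $M$ (a forest), live otherwise. The baseline $b_\sigma\in\mathbb N^\sigma$ is $b_\sigma(i)=|C_i\cap U_\sigma|$; $\mathbb N^\sigma$ is identified with the vectors in $\mathbb N^R$ vanishing outside $\sigma$. $\sigma$ can be fired from $a\in\mathbb N^R$ if $a_i\ge b_\sigma(i)$ for all $i\in\sigma$. For dead $\sigma$, the dead node is $K_\sigma=(M|A_\sigma)/U_\sigma$. For a matroid $N$ of rank $d$, $h(N)=(h_0,\dots,h_d)$ is the $h$-vector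 of its independence complex: $T_N(x,1)=\sum_kh_kx^{d-k}$. A multicomplex is a finite set of monomials (exponent vectors) closed under division; it is pure if all maximal elements have the same degree $|a|=\sum a_i$; its degree sequence counts elements of each degree (trailing zeros ignored). Fibres (recursively along inclusion): given fibres $F(\tau)$ at all dead $\tau\subsetneq\sigma$, a fibre at a dead stratum $\sigma$ is a set $F(\sigma)\subseteq\mathbb N^\sigma$ such that (i) $F(\sigma)$ is a pure multicomplex with degree sequence $h(K_\sigma)$; (ii) for every $m\in F(\sigma)$, every stratum $\tau\subsetneq\sigma$ that can be fired from $b_\sigma+m$ is dead with $(b_\sigma+m)|_\tau-b_\tau\in F(\tau)$. A dead stratum at which no fibre exists, for the fibres chosen at the dead strata strictly inside it, is obstructed. A fibre system on $(M,B_0)$ is a choice of a fibre at every dead stratum. *)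

theory Defs
  imports "HOL-Computational_Algebra.Polynomial"
begin

section \<open>Matroids\<close>

text \<open>
  The record carries only the data of a matroid (a ground set and its independent sets), not the
  matroid axioms; it is used below for graphic matroids of finite graphs and their minors.
\<close>

record 'e matroid =
  ground :: "'e set"
  indep :: "'e set \<Rightarrow> bool"

definition rank_of :: "'e matroid \<Rightarrow> 'e set \<Rightarrow> nat" where
  "rank_of M X = Max {card I | I. I \<subseteq> X \<and> indep M I}"

definition matroid_rank :: "'e matroid \<Rightarrow> nat" where
  "matroid_rank M = rank_of M (ground M)"

definition basis :: "'e matroid \<Rightarrow> 'e set \<Rightarrow> bool" where
  "basis M B \<longleftrightarrow>
     B \<subseteq> ground M \<and> indep M B \<and> (\<forall>I. indep M I \<and> I \<subseteq> ground M \<and> B \<subseteq> I \<longrightarrow> I = B)"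

definition circuit :: "'e matroid \<Rightarrow> 'e set \<Rightarrow> bool" where
  "circuit M C \<longleftrightarrow> C \<subseteq> ground M \<and> \<not> indep M C \<and> (\<forall>D. D \<subset> C \<longrightarrow> indep M D)"

definition restriction :: "'e matroid \<Rightarrow> 'e set \<Rightarrow> 'e matroid" where
  "restriction M A = \<lparr>ground = ground M \<inter> A, indep = (\<lambda>I. indep M I \<and> I \<subseteq> A)\<rparr>"

definition contraction :: "'e matroid \<Rightarrow> 'e set \<Rightarrow> 'e matroid" where
  "contraction M T =
     \<lparr>ground = ground M - T,
      indep = (\<lambda>I. I \<subseteq> ground M - T \<and> (\<exists>B. basis (restriction M T) B \<and> indep M (I \<union> B)))\<rparr>"

definition tutte :: "'e matroid \<Rightarrow> 'r::comm_ring_1 \<Rightarrow> 'r \<Rightarrow> 'r" where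
  "tutte M x y =
     (\<Sum>A\<in>Pow (ground M).
        (x - 1) ^ (matroid_rank M - rank_of M A) * (y - 1) ^ (card A - rank_of M A))"

text \<open>
  The list \<open>[h\<^sub>0, \<dots>, h\<^sub>d]\<close> with \<open>T\<^sub>M(x,1) = \<Sum>\<^sub>k h\<^sub>k x\<^sup>d\<^sup>-\<^sup>k\<close>, where \<open>d\<close> is the rank; the
  Tutte polynomial is evaluated at the polynomial indeterminate \<open>x = [:0, 1:]\<close> and at \<open>y = 1\<close>.
\<close>

definition h_vector :: "'e matroid \<Rightarrow> int list" where
  "h_vector M =
     map (\<lambda>k. coeff (tutte M [:0, 1:] 1) (matroid_rank M - k)) [0..<Suc (matroid_rank M)]"

section \<open>Strata\<close>

definition fund_circuit :: "'e matroid \<Rightarrow> 'e set \<Rightarrow> 'e \<Rightarrow> 'e set" where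
  "fund_circuit M B i = (THE C. circuit M C \<and> C \<subseteq> insert i B)"

definition mult :: "'e matroid \<Rightarrow> 'e set \<Rightarrow> 'e set \<Rightarrow> 'e \<Rightarrow> nat" where
  "mult M B \<sigma> e = card {i \<in> \<sigma>. e \<in> fund_circuit M B i}"

definition U_set :: "'e matroid \<Rightarrow> 'e set \<Rightarrow> 'e set \<Rightarrow> 'e set" where
  "U_set M B \<sigma> = {e \<in> ground M. mult M B \<sigma> e = 1}"

definition A_set :: "'e matroid \<Rightarrow> 'e set \<Rightarrow> 'e set \<Rightarrow> 'e set" where
  "A_set M B \<sigma> = {e \<in> ground M. mult M B \<sigma> e \<ge> 1}"

definition stratum :: "'e matroid \<Rightarrow> 'e set \<Rightarrow> 'e set \<Rightarrow> bool" where
  "stratum M B \<sigma> \<longleftrightarrow> \<sigma> \<noteq> {} \<and> \<sigma> \<subseteq> ground M - B"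

definition dead :: "'e matroid \<Rightarrow> 'e set \<Rightarrow> 'e set \<Rightarrow> bool" where
  "dead M B \<sigma> \<longleftrightarrow> stratum M B \<sigma> \<and> indep M (U_set M B \<sigma>)"

definition dead_node :: "'e matroid \<Rightarrow> 'e set \<Rightarrow> 'e set \<Rightarrow> 'e matroid" where
  "dead_node M B \<sigma> = contraction (restriction M (A_set M B \<sigma>)) (U_set M B \<sigma>)"

text \<open>Vectors in \<open>\<nat>\<^sup>\<sigma>\<close> are functions on all edges that vanish outside \<open>\<sigma>\<close>.\<close>

definition vectors_on :: "'e set \<Rightarrow> ('e \<Rightarrow> nat) set" where
  "vectors_on \<sigma> = {a. \<forall>i. i \<notin> \<sigma> \<longrightarrow> a i = 0}"

definition baseline :: "'e matroid \<Rightarrow> 'e set \<Rightarrow> 'e set \<Rightarrow> 'e \<Rightarrow> nat" where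
  "baseline M B \<sigma> i = (if i \<in> \<sigma> then card (fund_circuit M B i \<inter> U_set M B \<sigma>) else 0)"

definition can_fire :: "'e matroid \<Rightarrow> 'e set \<Rightarrow> 'e set \<Rightarrow> ('e \<Rightarrow> nat) \<Rightarrow> bool" where
  "can_fire M B \<sigma> a \<longleftrightarrow> (\<forall>i\<in>\<sigma>. a i \<ge> baseline M B \<sigma> i)"

section \<open>Multicomplexes\<close>

text \<open>
  A monomial is its exponent vector, so divisibility is the pointwise order \<open>\<le>\<close> on functions.
\<close>

definition monom_degree :: "('e \<Rightarrow> nat) \<Rightarrow> nat" where
  "monom_degree a = (\<Sum>i | a i \<noteq> 0. a i)"

definition multicomplex :: "('e \<Rightarrow> nat) set \<Rightarrow> bool" where
  "multicomplex F \<longleftrightarrow> finite F \<and> (\<forall>b\<in>F. \<forall>a. a \<le> b \<longrightarrow> a \<in> F)"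

definition maximal_in :: "('e \<Rightarrow> nat) set \<Rightarrow> ('e \<Rightarrow> nat) \<Rightarrow> bool" where
  "maximal_in F a \<longleftrightarrow> a \<in> F \<and> (\<forall>b\<in>F. a \<le> b \<longrightarrow> b = a)"

definition pure_multicomplex :: "('e \<Rightarrow> nat) set \<Rightarrow> bool" where
  "pure_multicomplex F \<longleftrightarrow> multicomplex F \<and>
     (\<forall>a b. maximal_in F a \<and> maximal_in F b \<longrightarrow> monom_degree a = monom_degree b)"

text \<open>Padding \<open>h\<close> by zeros amounts to ignoring trailing zeros.\<close>

definition has_degree_sequence :: "('e \<Rightarrow> nat) set \<Rightarrow> int list \<Rightarrow> bool" where
  "has_degree_sequence F h \<longleftrightarrow>
     (\<forall>k. int (card {a \<in> F. monom_degree a = k}) = nth_default 0 h k)"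

section \<open>Fibres\<close>

text \<open>
  \<open>is_fibre M B F \<sigma> X\<close> says that \<open>X\<close> is a fibre at \<open>\<sigma>\<close> relative to the family \<open>F\<close>, of which only
  the values at dead strata strictly inside \<open>\<sigma>\<close> are consulted.
\<close>

definition is_fibre ::
  "'e matroid \<Rightarrow> 'e set \<Rightarrow> ('e set \<Rightarrow> ('e \<Rightarrow> nat) set) \<Rightarrow> 'e set \<Rightarrow> ('e \<Rightarrow> nat) set \<Rightarrow> bool" where
  "is_fibre M B F \<sigma> X \<longleftrightarrow>
     X \<subseteq> vectors_on \<sigma> \<and>
     pure_multicomplex X \<and>
     has_degree_sequence X (h_vector (dead_node M B \<sigma>)) \<and>
     (\<forall>m\<in>X. \<forall>\<tau>. stratum M B \<tau> \<and> \<tau> \<subset> \<sigma> \<and> can_fire M B \<tau> (\<lambda>i. baseline M B \<sigma> i + m i) \<longrightarrow>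
        dead M B \<tau> \<and>
        (\<lambda>i. if i \<in> \<tau> then baseline M B \<sigma> i + m i - baseline M B \<tau> i else 0) \<in> F \<tau>)"

definition fibres_strictly_inside ::
  "'e matroid \<Rightarrow> 'e set \<Rightarrow> ('e set \<Rightarrow> ('e \<Rightarrow> nat) set) \<Rightarrow> 'e set \<Rightarrow> bool" where
  "fibres_strictly_inside M B F \<sigma> \<longleftrightarrow>
     (\<forall>\<tau>. dead M B \<tau> \<and> \<tau> \<subset> \<sigma> \<longrightarrow> is_fibre M B F \<tau> (F \<tau>))"

definition obstructed ::
  "'e matroid \<Rightarrow> 'e set \<Rightarrow> ('e set \<Rightarrow> ('e \<Rightarrow> nat) set) \<Rightarrow> 'e set \<Rightarrow> bool" where
  "obstructed M B F \<sigma> \<longleftrightarrow> dead M B \<sigma> \<and> \<not> (\<exists>X. is_fibre M B F \<sigma> X)"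

definition fibre_system ::
  "'e matroid \<Rightarrow> 'e set \<Rightarrow> ('e set \<Rightarrow> ('e \<Rightarrow> nat) set) \<Rightarrow> bool" where
  "fibre_system M B F \<longleftrightarrow> (\<forall>\<sigma>. dead M B \<sigma> \<longrightarrow> is_fibre M B F \<sigma> (F \<sigma>))"

section \<open>Graphic matroids of simple graphs\<close>

record 'v ugraph =
  verts :: "'v set"
  edges :: "'v set set"

definition cycle_edges :: "'v list \<Rightarrow> 'v set set" where
  "cycle_edges p = {{p ! i, p ! (Suc i mod length p)} | i. i < length p}"

definition forest :: "'v set set \<Rightarrow> bool" where
  "forest F \<longleftrightarrow> \<not> (\<exists>p. length p \<ge> 3 \<and> distinct p \<and> cycle_edges p \<subseteq> F)"

definition graphic_matroid :: "'v ugraph \<Rightarrow> 'v set matroid" where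
  "graphic_matroid G = \<lparr>ground = edges G, indep = (\<lambda>F. F \<subseteq> edges G \<and> forest F)\<rparr>"

section \<open>The graph \<open>G\<^sub>4\<close>\<close>

text \<open>\<open>Org\<close> is the vertex \<open>o\<close>, \<open>Hub j\<close> the vertex \<open>j\<close> and \<open>V j\<close> the vertex \<open>v\<^sub>j\<close>.\<close>

datatype vertex = Org | Hub nat | V nat

definition path_edge :: "nat \<Rightarrow> vertex set" where
  "path_edge i = {V (i - 1), V i}"

definition G4_R :: "vertex set set" where
  "G4_R = path_edge ` {1..7}"

definition G4 :: "vertex ugraph" where
  "G4 = \<lparr>verts = {Org} \<union> Hub ` {1..3} \<union> V ` {0..7},
         edges = {{Org, Hub 1}, {Org, Hub 2}, {Org, Hub 3},
                  {Hub 1, V 0}, {Hub 1, V 3}, {Hub 1, V 6},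
                  {Hub 2, V 1}, {Hub 2, V 4}, {Hub 2, V 7},
                  {Hub 3, V 2}, {Hub 3, V 5}} \<union> G4_R\<rparr>"

definition G4_B0 :: "vertex set set" where
  "G4_B0 = edges G4 - G4_R"

lemma G4_R_subset: "G4_R \<subseteq> edges G4"
  unfolding G4_def ugraph.simps by (rule Un_upper2)

lemma ground_minus_G4_B0: "ground (graphic_matroid G4) - G4_B0 = G4_R"
  using G4_R_subset by (auto simp: graphic_matroid_def G4_B0_def)

lemma G4_B0_eq:
  "G4_B0 = {{Org, Hub 1}, {Org, Hub 2}, {Org, Hub 3},
            {Hub 1, V 0}, {Hub 1, V 3}, {Hub 1, V 6},
            {Hub 2, V 1}, {Hub 2, V 4}, {Hub 2, V 7},
            {Hub 3, V 2}, {Hub 3, V 5}}"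
    (is "_ = ?T")
proof -
  have "\<exists>x\<in>e. \<forall>j. x \<noteq> V j" if "e \<in> ?T" for e
    using that by (elim insertE) simp_all
  moreover have "\<forall>x\<in>e. \<exists>j. x = V j" if "e \<in> G4_R" for e
    using that by (auto simp: G4_R_def path_edge_def)
  ultimately have "?T \<inter> G4_R = {}"
    by (metis disjoint_iff)
  then show ?thesis
    unfolding G4_B0_def G4_def ugraph.simps Un_Diff by (simp only: Diff_triv Diff_cancel Un_empty_right)
qed

lemma G4_R_eq:
  "G4_R = {{V 0, V 1}, {V 1, V 2}, {V 2, V 3}, {V 3, V 4}, {V 4, V 5}, {V 5, V 6}, {V 6, V 7}}"
proof -
  have "{1..7} = {1, 2, 3, 4, 5, 6, 7 :: nat}"
    by auto
  then show ?thesis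
    by (simp add: G4_R_def path_edge_def)
qed

lemma card_G4: "card (verts G4) = 12" "card (edges G4) = 18" "card G4_B0 = 11" "card G4_R = 7"
proof -
  show "card G4_B0 = 11" "card G4_R = 7"
    by (simp_all add: G4_B0_eq G4_R_eq doubleton_eq_iff)
  have "finite G4_R"
    by (simp add: G4_R_def)
  with G4_R_subset have "card G4_B0 = card (edges G4) - card G4_R"
    unfolding G4_B0_def by (simp add: card_Diff_subset)
  then show "card (edges G4) = 18"
    using \<open>card G4_B0 = 11\<close> \<open>card G4_R = 7\<close> by linarith
  have "{1..3} = {1, 2, 3 :: nat}" "{0..7} = {0, 1, 2, 3, 4, 5, 6, 7 :: nat}"
    by auto
  then show "card (verts G4) = 12"
    by (simp add: G4_def)
qed

fun parent :: "vertex \<Rightarrow> vertex" where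
  "parent Org = Org"
| "parent (Hub j) = Org"
| "parent (V j) = Hub (if j mod 3 = 0 then 1 else if j mod 3 = 1 then 2 else 3)"

fun height :: "vertex \<Rightarrow> nat" where
  "height Org = 0"
| "height (Hub j) = 1"
| "height (V j) = 2"

lemma G4_B0_parent:
  "G4_B0 = (\<lambda>c. {parent c, c}) ` {Hub 1, Hub 2, Hub 3, V 0, V 3, V 6, V 1, V 4, V 7, V 2, V 5}"
  unfolding G4_B0_eq image_insert image_empty by simp

lemma G4_B0_cases:
  assumes "e \<in> G4_B0"
  shows "\<exists>c. e = {parent c, c} \<and> height (parent c) < height c"
proof -
  obtain c where c: "e = {parent c, c}"
      and "c \<in> {Hub 1, Hub 2, Hub 3, V 0, V 3, V 6, V 1, V 4, V 7, V 2, V 5}"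
    using assms unfolding G4_B0_parent by (rule imageE)
  from this(2) have "height (parent c) < height c"
    by (elim insertE) simp_all
  with c show ?thesis
    by blast
qed

lemma cycle_edges_5:
  "cycle_edges [a, b, c, d, e] = {{a, b}, {b, c}, {c, d}, {d, e}, {e, a}}"
proof -
  have "{i. i < length [a, b, c, d, e]} =
        {0, Suc 0, Suc (Suc 0), Suc (Suc (Suc 0)), Suc (Suc (Suc (Suc 0)))}"
    by auto
  then show ?thesis
    unfolding cycle_edges_def setcompr_eq_image by (simp only:) simp
qed

lemma forest_G4_B0: "forest G4_B0"
  unfolding forest_def
proof
  assume "\<exists>p. length p \<ge> 3 \<and> distinct p \<and> cycle_edges p \<subseteq> G4_B0"
  then obtain p where p: "length p \<ge> 3" "distinct p" "cycle_edges p \<subseteq> G4_B0"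
    by blast
  let ?n = "length p"
  have tree: "x = parent y \<or> y = parent x \<and> height x > height y" "y = parent x \<or> x = parent y \<and> height y > height x"
    if xy: "{x, y} \<in> G4_B0" for x y
  proof -
    obtain c where c: "{x, y} = {parent c, c}" "height (parent c) < height c"
      using G4_B0_cases[OF xy] by blast
    from c show "x = parent y \<or> y = parent x \<and> height x > height y"
      and "y = parent x \<or> x = parent y \<and> height y > height x"
      unfolding doubleton_eq_iff by blast+
  qed
  have edge: "{p ! i, p ! (Suc i mod ?n)} \<in> G4_B0" if "i < ?n" for i
    using p(3) that by (auto simp: cycle_edges_def)
  define h where "h = Max (height ` set p)"
  have fin: "finite (height ` set p)" "height ` set p \<noteq> {}"
    using p(1) by auto
  then have "h \<in> height ` set p"
    unfolding h_def by (rule Max_in)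
  then obtain k where k: "k < ?n" "height (p ! k) = h"
    by (auto simp: in_set_conv_nth)
  have le: "height (p ! i) \<le> height (p ! k)" if "i < ?n" for i
    using that fin k(2) by (simp add: h_def)
  define a where "a = (if k = 0 then ?n - 1 else k - 1)"
  define b where "b = Suc k mod ?n"
  have "0 < ?n"
    using k(1) by linarith
  then have ab: "a < ?n" "b < ?n" "Suc a mod ?n = k"
    using p(1) k by (auto simp: a_def b_def simp del: length_greater_0_conv)
  have "a \<noteq> b"
    using p(1) k by (cases "Suc k = ?n") (auto simp: a_def b_def)
  then have "p ! a \<noteq> p ! b"
    using p(2) ab by (simp add: nth_eq_iff_index_eq)
  moreover have "p ! a = parent (p ! k)"
    using tree(1)[OF edge[OF ab(1)]] ab le[OF ab(1)] le[OF ab(2)] by auto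
  moreover have "p ! b = parent (p ! k)"
    using tree(2)[OF edge[OF k(1)]] le[OF ab(2)] by (auto simp: b_def)
  ultimately show False
    by simp
qed

lemma path_to_root:
  assumes "j \<le> 7"
  shows "{V j, parent (V j)} \<in> G4_B0" "{parent (V j), Org} \<in> G4_B0"
proof -
  let ?S = "{Hub 1, Hub 2, Hub 3, V 0, V 3, V 6, V 1, V 4, V 7, V 2, V 5}"
  have edge: "{c, parent c} \<in> G4_B0" if "c \<in> ?S" for c
    using imageI[OF that, of "\<lambda>c. {parent c, c}"] unfolding G4_B0_parent
    by (subst insert_commute)
  have "j = 0 \<or> j = 1 \<or> j = 2 \<or> j = 3 \<or> j = 4 \<or> j = 5 \<or> j = 6 \<or> j = 7"
    using assms by linarith
  then have "V j \<in> ?S"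
    by (elim disjE) simp_all
  then show "{V j, parent (V j)} \<in> G4_B0"
    by (rule edge)
  have "parent (V j) \<in> ?S"
    by simp
  then have "{parent (V j), parent (parent (V j))} \<in> G4_B0"
    by (rule edge)
  moreover have "parent (parent (V j)) = Org"
    by simp
  ultimately show "{parent (V j), Org} \<in> G4_B0"
    by (simp only:)
qed

lemma basis_G4_B0: "basis (graphic_matroid G4) G4_B0"
  unfolding basis_def
proof (intro conjI allI impI)
  show "G4_B0 \<subseteq> ground (graphic_matroid G4)"
    by (simp add: graphic_matroid_def G4_B0_def)
  then show "indep (graphic_matroid G4) G4_B0"
    using forest_G4_B0 by (simp add: graphic_matroid_def)
  fix I assume "indep (graphic_matroid G4) I \<and> I \<subseteq> ground (graphic_matroid G4) \<and> G4_B0 \<subseteq> I"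
  then have I: "forest I" "I \<subseteq> edges G4" "G4_B0 \<subseteq> I"
    by (auto simp: graphic_matroid_def)
  have False if "path_edge i \<in> I" "i \<in> {1..7}" for i
  proof -
    let ?p = "[V (i - 1), parent (V (i - 1)), Org, parent (V i), V i]"
    have le: "i - 1 \<le> 7" "i \<le> 7"
      using that(2) by auto
    have i: "i = 1 \<or> i = 2 \<or> i = 3 \<or> i = 4 \<or> i = 5 \<or> i = 6 \<or> i = 7"
      using that(2) by auto
    have cyc: "cycle_edges ?p = {{V (i - 1), parent (V (i - 1))}, {parent (V (i - 1)), Org},
                 {Org, parent (V i)}, {parent (V i), V i}, {V i, V (i - 1)}}"
      by (rule cycle_edges_5)
    have tree: "{{V (i - 1), parent (V (i - 1))}, {parent (V (i - 1)), Org},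
                 {Org, parent (V i)}, {parent (V i), V i}} \<subseteq> G4_B0"
      using le path_to_root[of "i - 1"] path_to_root[of i]
      by (simp add: insert_commute del: parent.simps)
    have chord: "{V i, V (i - 1)} \<in> I"
      using that(1) by (simp add: path_edge_def insert_commute)
    have "cycle_edges ?p \<subseteq> I"
      unfolding cyc using order_trans[OF tree I(3)] chord
      by (simp only: insert_subset empty_subsetI simp_thms)
    moreover have "distinct ?p"
      using i by (elim disjE) simp_all
    moreover have "length ?p \<ge> 3"
      by simp
    ultimately show False
      using I(1) unfolding forest_def by blast
  qed
  then have "I \<inter> G4_R = {}"
    unfolding G4_R_def by blast
  then show "I = G4_B0"
    using I(2,3) unfolding G4_B0_def by blast
qed

end

theory Submission
  imports Defs
begin

text \<open>
  Write \<open>x\<^sub>i\<close> for the variable of the chord \<open>e\<^sub>i\<close>. Firing a stratum from the baseline of \<open>R\<close>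
  plus a monomial \<open>m\<close> is only permitted when that stratum is dead, so each live stratum
  excludes monomials from a fibre at \<open>R\<close>, and these exclusions do not depend on the fibres
  chosen further inside. The baseline of \<open>R\<close> is \<open>(2,1,1,1,1,1,2)\<close>. The intervals \<open>e\<^sub>1..e\<^sub>3\<close>,
  \<open>e\<^sub>5..e\<^sub>7\<close>, \<open>e\<^sub>1..e\<^sub>6\<close> and \<open>e\<^sub>2..e\<^sub>7\<close> each join two path vertices hanging from the same hub, so
  they are live; their baselines exceed that of \<open>R\<close> at a single chord only, and therefore
  forbid \<open>x\<^sub>3\<close>, \<open>x\<^sub>5\<close>, \<open>x\<^sub>6\<close> and \<open>x\<^sub>2\<close>. In the remaining variables \<open>x\<^sub>1, x\<^sub>4, x\<^sub>7\<close> the live strata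
  \<open>{1,4,5,6,7}\<close>, \<open>{1,2,3,4,7}\<close> and \<open>{1,7}\<close> forbid the three mixed products
  (\<open>fibre_vanishing\<close>). Only the squares \<open>x\<^sub>1\<^sup>2, x\<^sub>4\<^sup>2, x\<^sub>7\<^sup>2\<close> are left in degree two
  (\<open>fibre_quadratic\<close>), whereas a fibre needs four quadratic monomials.

  That number comes from the dead node. \<open>U\<^sub>R\<close> is the whole path, prolonged by one edge at each
  end to the hubs 1 and 2; contracting it leaves a triangle on \<open>o\<close>, hub 3 and the contracted
  path, with edge multiplicities 1, 2, 2, together with four loops. This graph has 1, 5 and 8
  forests with 0, 1 and 2 edges, and \<open>(x-1)\<^sup>2 + 5(x-1) + 8 = x\<^sup>2 + 3x + 4\<close> (\<open>h_vector_K4\<close>).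

  To make all this a finite calculation, edges are named by labels, and fundamental circuits,
  multiplicities and baselines are computed on lists of labels (\<open>fund_circuit_M4\<close>, \<open>U_M4\<close>,
  \<open>baseline_M4\<close>).
\<close>

section \<open>Forests and cycles\<close>

lemma cycle_edges_zip: "cycle_edges p = set (map2 (\<lambda>a b. {a, b}) p (rotate1 p))"
proof -
  have "cycle_edges p = (\<lambda>i. {p ! i, rotate1 p ! i}) ` {..<length p}"
    by (auto simp: cycle_edges_def nth_rotate1)
  also have "\<dots> = set (map2 (\<lambda>a b. {a, b}) p (rotate1 p))"
    by (force simp: set_zip image_iff)
  finally show ?thesis .
qed

lemma not_forestI:
  assumes "3 \<le> length p" "distinct p" "set (map2 (\<lambda>a b. {a, b}) p (rotate1 p)) \<subseteq> F"
  shows "\<not> forest F"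
  using assms unfolding forest_def cycle_edges_zip by blast

lemma forest_subset: "forest F \<Longrightarrow> F' \<subseteq> F \<Longrightarrow> forest F'"
  unfolding forest_def by (meson order_trans)

text \<open>
  The tool for certifying forests without enumerating cycles: a vertex labelling that is
  constant along \<open>F\<close> but separates \<open>u\<close> from \<open>v\<close> would have to change exactly once around a
  cycle through \<open>uv\<close>, which is impossible.
\<close>

lemma forest_insert_cut:
  assumes F: "forest F" and inv: "\<And>a b. {a, b} \<in> F \<Longrightarrow> f a = f b" and uv: "f u \<noteq> f v"
  shows "forest (insert {u, v} F)"
  unfolding forest_def
proof
  assume "\<exists>p. length p \<ge> 3 \<and> distinct p \<and> cycle_edges p \<subseteq> insert {u, v} F"
  then obtain p where p: "length p \<ge> 3" "distinct p" "cycle_edges p \<subseteq> insert {u, v} F"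
    by blast
  let ?n = "length p" and ?s = "\<lambda>i. Suc i mod length p"
  have "{u, v} \<in> cycle_edges p"
    using F p unfolding forest_def by blast
  then obtain k where k: "k < ?n" "{p ! k, p ! ?s k} = {u, v}"
    by (auto simp: cycle_edges_def)
  have keep: "f (p ! ?s j) = f (p ! j)" if j: "j < ?n" "j \<noteq> k" for j
  proof -
    have "?n > 0"
      using p(1) by linarith
    then have s: "?s j < ?n" "?s k < ?n"
      by (simp_all only: mod_less_divisor)
    have "{p ! j, p ! ?s j} \<noteq> {p ! k, p ! ?s k}"
    proof
      assume "{p ! j, p ! ?s j} = {p ! k, p ! ?s k}"
      then have "j = ?s k \<and> ?s j = k"
        using j k(1) s p(2) by (auto simp: doubleton_eq_iff nth_eq_iff_index_eq)
      then show False
        using p(1) k(1) j by (auto simp: mod_Suc split: if_splits)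
    qed
    then have "{p ! j, p ! ?s j} \<in> F"
      using p(3) j k(2) by (auto simp: cycle_edges_def)
    from inv[OF this] show ?thesis
      by simp
  qed
  \<comment> \<open>Start behind the edge \<open>uv\<close> and go round the cycle the long way, back to \<open>uv\<close>.\<close>
  have walk: "f (p ! ((Suc k + t) mod ?n)) = f (p ! ?s k)" if "t < ?n" for t
    using that
  proof (induction t)
    case (Suc t)
    let ?j = "(Suc k + t) mod ?n"
    have "?j \<noteq> k"
    proof
      assume eq: "?j = k"
      show False
      proof (cases "Suc k + t < ?n")
        case False
        then have "?j = Suc k + t - ?n"
          using k(1) Suc.prems by (subst mod_if) auto
        with eq False Suc.prems show False
          by linarith
      qed (use eq in simp)
    qed
    moreover have "0 < ?n"
      using p(1) by linarith
    then have "?j < ?n"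
      by (rule mod_less_divisor)
    moreover have "?s ?j = (Suc k + Suc t) mod ?n"
      by (simp add: mod_Suc_eq)
    ultimately show ?case
      using keep[of ?j] Suc by simp
  qed simp
  have "(Suc k + (?n - 1)) mod ?n = k"
  proof -
    have "Suc k + (?n - 1) = k + ?n"
      using k(1) by linarith
    then show ?thesis
      using k(1) by simp
  qed
  then have "f (p ! k) = f (p ! ?s k)"
    using walk[of "?n - 1"] p(1) by simp
  with k(2) uv show False
    by (auto simp: doubleton_eq_iff)
qed

lemma forest_insert_leaf:
  assumes "forest F" "v \<notin> \<Union>F" "u \<noteq> v"
  shows "forest (insert {u, v} F)"
  using assms by (intro forest_insert_cut[where f = "\<lambda>x. x = v"]) auto

lemma forest_empty: "forest {}"
  unfolding forest_def cycle_edges_def by force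

section \<open>Contraction of an independent set and the Tutte polynomial at y = 1\<close>

lemma indep_contraction_indep:
  assumes "U \<subseteq> ground M" "indep M U"
  shows "indep (contraction M U) I \<longleftrightarrow> I \<subseteq> ground M - U \<and> indep M (I \<union> U)"
proof -
  have "basis (restriction M U) B \<longleftrightarrow> B = U" for B
    using assms by (auto simp: basis_def restriction_def)
  then show ?thesis
    by (simp add: contraction_def)
qed

text \<open>
  If deleting any element of \<open>C\<close> makes \<open>B + e\<close> independent, then every dependent subset of
  \<open>B + e\<close> contains \<open>C\<close>; so \<open>C\<close> is both minimal and the only candidate.
\<close>

lemma fund_circuit_eqI:
  assumes sub: "C \<subseteq> insert e B" "insert e B \<subseteq> ground M" and dep: "\<not> indep M C"
    and exch: "\<And>f D. f \<in> C \<Longrightarrow> D \<subseteq> insert e B - {f} \<Longrightarrow> indep M D"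
  shows "fund_circuit M B e = C"
  unfolding fund_circuit_def
proof (rule the_equality)
  have key: "indep M D" if D: "D \<subseteq> insert e B" "\<not> C \<subseteq> D" for D
  proof -
    obtain f where "f \<in> C" "f \<notin> D"
      using D(2) by blast
    with D(1) show ?thesis
      by (intro exch[of f]) blast+
  qed
  show "circuit M C \<and> C \<subseteq> insert e B"
    unfolding circuit_def
  proof (intro conjI allI impI)
    show "indep M D" if "D \<subset> C" for D
      using that sub(1) by (intro key) blast+
  qed (use sub dep in blast)+
  show "D = C" if D: "circuit M D \<and> D \<subseteq> insert e B" for D
  proof -
    have "C \<subseteq> D"
      using D key[of D] unfolding circuit_def by blast
    moreover have "\<not> C \<subset> D"
      using D dep unfolding circuit_def by blast
    ultimately show ?thesis
      by blast
  qed
qed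

text \<open>
  The power of \<open>y - 1\<close> with exponent the nullity is \<open>0\<close> at \<open>y = 1\<close> except when the nullity is zero, where
  \<open>0 ^ 0 = 1\<close>; so the independent sets are the only sets that contribute.
\<close>

lemma tutte_at_y_1:
  assumes fin: "finite (ground M)" and e: "indep M {}"
  shows "tutte M x 1 = (\<Sum>I | I \<subseteq> ground M \<and> indep M I. (x - 1) ^ (matroid_rank M - card I))"
proof -
  have fam: "finite {card I |I. I \<subseteq> A \<and> indep M I}" "{card I |I. I \<subseteq> A \<and> indep M I} \<noteq> {}"
    if "finite A" for A
    using that e by (auto simp: setcompr_eq_image)
  have r: "rank_of M A = card A" if "A \<subseteq> ground M" "indep M A" for A
    unfolding rank_of_def
  proof (rule Max_eqI)
    have A: "finite A" using that fin finite_subset by blast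
    show "finite {card I |I. I \<subseteq> A \<and> indep M I}" by (rule fam[OF A])
    show "card A \<in> {card I |I. I \<subseteq> A \<and> indep M I}" using that by blast
    show "y \<le> card A" if "y \<in> {card I |I. I \<subseteq> A \<and> indep M I}" for y
      using that A by (auto intro: card_mono)
  qed
  have d: "rank_of M A < card A" if "A \<subseteq> ground M" "\<not> indep M A" for A
  proof -
    have A: "finite A" using that fin finite_subset by blast
    obtain I where I: "I \<subseteq> A" "indep M I" "rank_of M A = card I"
      using Max_in[OF fam[OF A]] unfolding rank_of_def by blast
    with that have "I \<subset> A" by blast
    with A I(3) show ?thesis by (simp add: psubset_card_mono)
  qed
  have "tutte M x 1 = (\<Sum>A\<in>Pow (ground M).
      if indep M A then (x - 1) ^ (matroid_rank M - card A) else 0)"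
    unfolding tutte_def by (rule sum.cong) (use r d in \<open>auto simp: zero_power\<close>)
  also have "\<dots> = (\<Sum>I\<in>Pow (ground M) \<inter> {A. indep M A}. (x - 1) ^ (matroid_rank M - card I))"
    using fin by (subst sum.inter_restrict) auto
  also have "Pow (ground M) \<inter> {A. indep M A} = {I. I \<subseteq> ground M \<and> indep M I}"
    by auto
  finally show ?thesis .
qed

section \<open>Combinatorial names for the edges of \<open>G\<^sub>4\<close>\<close>

text \<open>
  Computing with edges as two-element sets of vertices needs a case split for every
  comparison. The labels name the edges freely and injectively (apart from \<open>Chord 0\<close>, which
  truncated subtraction turns into a degenerate edge), so set operations on edges become
  decidable list operations. \<open>Root k\<close> joins \<open>o\<close> to a hub, \<open>Stub j\<close> joins \<open>v\<^sub>j\<close> to its hub, and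
  \<open>Chord i\<close> is \<open>e\<^sub>i\<close>.
\<close>

datatype label = Root nat | Stub nat | Chord nat

fun edge :: "label \<Rightarrow> vertex set" where
  "edge (Root k) = {Org, Hub k}"
| "edge (Stub j) = {parent (V j), V j}"
| "edge (Chord i) = {V (i - 1), V i}"

abbreviation chord :: "nat \<Rightarrow> vertex set" where
  "chord i \<equiv> edge (Chord i)"

definition tree_labels :: "label list" where
  "tree_labels = [Root 1, Root 2, Root 3,
    Stub 0, Stub 1, Stub 2, Stub 3, Stub 4, Stub 5, Stub 6, Stub 7]"

definition labels :: "label list" where
  "labels = tree_labels @ [Chord 1, Chord 2, Chord 3, Chord 4, Chord 5, Chord 6, Chord 7]"

definition hub :: "nat \<Rightarrow> nat" where
  "hub j = (if j mod 3 = 0 then 1 else if j mod 3 = 1 then 2 else 3)"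

definition circuit_labels :: "nat \<Rightarrow> label list" where
  "circuit_labels i = [Chord i, Stub (i - 1), Stub i, Root (hub (i - 1)), Root (hub i)]"

abbreviation M4 :: "vertex set matroid" where
  "M4 \<equiv> graphic_matroid G4"

lemma inj_edge: "inj_on edge (set labels)"
proof -
  have "a = b" if "edge a = edge b" "a \<noteq> Chord 0" "b \<noteq> Chord 0" for a b
    using that by (cases a; cases b) (auto simp: doubleton_eq_iff)
  moreover have "Chord 0 \<notin> set labels"
    by (simp add: labels_def tree_labels_def)
  ultimately show ?thesis
    by (metis inj_onI)
qed

lemma B0_edge: "G4_B0 = edge ` set tree_labels"
  unfolding G4_B0_eq tree_labels_def by (auto simp: insert_commute)

lemma edges_edge: "edges G4 = edge ` set labels"
proof -
  have "edges G4 = G4_B0 \<union> G4_R"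
    using G4_R_subset by (auto simp: G4_B0_def)
  then show ?thesis
    unfolding B0_edge G4_R_eq labels_def by auto
qed

lemma R_edge: "G4_R = chord ` set [1, 2, 3, 4, 5, 6, 7]"
  unfolding G4_R_eq by simp

lemma index_cases: "i \<in> {1..7} \<longleftrightarrow> i = 1 \<or> i = 2 \<or> i = 3 \<or> i = 4 \<or> i = 5 \<or> i = 6 \<or> i = (7 :: nat)"
  by auto

lemma edge_Root_hub: "edge (Root (hub j)) = {Org, parent (V j)}"
  by (simp add: hub_def)

lemma ground_M4: "ground M4 = edge ` set labels"
  by (simp add: graphic_matroid_def edges_edge)

lemma indep_M4: "indep M4 I \<longleftrightarrow> I \<subseteq> edge ` set labels \<and> forest I"
  by (simp add: graphic_matroid_def edges_edge)

lemma chord_in_labels: "i \<in> {1..7} \<Longrightarrow> Chord i \<in> set labels"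
  unfolding index_cases by (elim disjE) (simp_all add: labels_def)

lemma tree_labels_subset: "set tree_labels \<subseteq> set labels"
  unfolding labels_def set_append by (rule Un_upper1)

lemma circuit_labels_subset: "i \<in> {1..7} \<Longrightarrow> set (circuit_labels i) \<subseteq> insert (Chord i) (set tree_labels)"
  unfolding index_cases by (elim disjE) (simp_all add: circuit_labels_def hub_def tree_labels_def)

text \<open>
  \<open>below c\<close> picks out the side of the cut that the tree edge above \<open>c\<close> defines, for \<open>c\<close> other
  than the root. Three terms suffice because the tree has height two.
\<close>

definition below :: "vertex \<Rightarrow> vertex \<Rightarrow> bool" where
  "below c x \<longleftrightarrow> c \<in> {x, parent x, parent (parent x)}"

fun child :: "label \<Rightarrow> vertex" where
  "child (Root k) = Hub k"
| "child (Stub j) = V j"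
| "child (Chord i) = V i"

lemma below_parent: "d \<noteq> c \<Longrightarrow> c \<noteq> Org \<Longrightarrow> below c (parent d) \<longleftrightarrow> below c d"
  by (cases d) (auto simp: below_def)

lemma tree_label_edge:
  assumes "l \<in> set tree_labels"
  shows "edge l = {parent (child l), child l}" "child l \<noteq> Org"
  by (insert assms, cases l; simp add: tree_labels_def)
     (insert assms, cases l; simp add: tree_labels_def)

lemma child_inj:
  assumes "l \<in> set tree_labels" "l' \<in> set tree_labels" "child l = child l'"
  shows "l = l'"
proof -
  have "Chord i \<notin> set tree_labels" for i
    by (simp add: tree_labels_def)
  then show ?thesis
    by (insert assms, cases l; cases l') auto
qed

lemma below_edge:
  assumes l: "l \<in> set tree_labels" "l' \<in> set tree_labels" "l' \<noteq> l" "{a, b} = edge l'"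
  shows "below (child l) a \<longleftrightarrow> below (child l) b"
proof -
  have "below (child l) (parent (child l')) \<longleftrightarrow> below (child l) (child l')"
    using l child_inj tree_label_edge(2) by (intro below_parent) blast+
  then show ?thesis
    using l(4) unfolding tree_label_edge(1)[OF l(2)] by (auto simp: doubleton_eq_iff)
qed

text \<open>
  Removing a tree edge of the fundamental circuit splits the tree into the vertices below it
  and the rest, and the chord joins the two sides.
\<close>

lemma exchange_forest:
  assumes i: "i \<in> {1..7}" and l: "l \<in> set (circuit_labels i)"
  shows "forest (insert (chord i) G4_B0 - {edge l})"
proof (cases "l = Chord i")
  case True
  then show ?thesis
    using forest_G4_B0 by (auto intro: forest_subset)
next
  case False
  then have lt: "l \<in> set tree_labels"
    using i l circuit_labels_subset by auto
  let ?F = "G4_B0 - {edge l}"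
  have "forest (insert {V (i - 1), V i} ?F)"
  proof (rule forest_insert_cut[where f = "below (child l)"])
    show "forest ?F"
      using forest_G4_B0 by (rule forest_subset) blast
    show "below (child l) a = below (child l) b" if "{a, b} \<in> ?F" for a b
      using that below_edge[OF lt] unfolding B0_edge by auto
    show "below (child l) (V (i - 1)) \<noteq> below (child l) (V i)"
    proof -
      have "l = Stub (i - 1) \<or> l = Stub i \<or> l = Root (hub (i - 1)) \<or> l = Root (hub i)"
        using l False by (auto simp: circuit_labels_def)
      moreover note i[unfolded index_cases]
      ultimately show ?thesis
        by (elim disjE; simp only: child.simps; simp add: hub_def below_def)
    qed
  qed
  then show ?thesis
    by (rule forest_subset) auto
qed

lemma circuit_labels_dependent:
  assumes i: "i \<in> {1..7}"
  shows "\<not> forest (edge ` set (circuit_labels i))"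
proof (rule not_forestI)
  let ?p = "[V (i - 1), parent (V (i - 1)), Org, parent (V i), V i]"
  show "distinct ?p"
    using i unfolding index_cases by (elim disjE) simp_all
  show "3 \<le> length ?p"
    by simp
  have "chord i = {V i, V (i - 1)}" "edge (Stub (i - 1)) = {V (i - 1), parent (V (i - 1))}"
    "edge (Stub i) = {parent (V i), V i}"
    "edge (Root (hub (i - 1))) = {parent (V (i - 1)), Org}" "edge (Root (hub i)) = {Org, parent (V i)}"
    unfolding edge_Root_hub by (simp_all only: edge.simps insert_commute)
  then show "set (map2 (\<lambda>a b. {a, b}) ?p (rotate1 ?p)) \<subseteq> edge ` set (circuit_labels i)"
    by (simp add: circuit_labels_def del: edge.simps parent.simps)
qed

lemma fund_circuit_M4:
  assumes i: "i \<in> {1..7}"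
  shows "fund_circuit M4 G4_B0 (chord i) = edge ` set (circuit_labels i)"
proof (rule fund_circuit_eqI)
  show "edge ` set (circuit_labels i) \<subseteq> insert (chord i) G4_B0"
    using image_mono[OF circuit_labels_subset[OF i], of edge] unfolding B0_edge image_insert .
  show ground: "insert (chord i) G4_B0 \<subseteq> ground M4"
    using chord_in_labels[OF i] tree_labels_subset unfolding B0_edge ground_M4 by blast
  show "\<not> indep M4 (edge ` set (circuit_labels i))"
    using circuit_labels_dependent[OF i] unfolding indep_M4 by blast
  fix f D assume "f \<in> edge ` set (circuit_labels i)" and D: "D \<subseteq> insert (chord i) G4_B0 - {f}"
  then have "forest D"
    using exchange_forest[OF i] forest_subset by blast
  then show "indep M4 D"
    using D ground unfolding indep_M4 ground_M4 by blast
qed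

section \<open>Strata by index lists\<close>

definition chords :: "nat list \<Rightarrow> vertex set set" where
  "chords s = chord ` set s"

text \<open>
  The next three functions mirror \<open>m\<^sub>\<sigma>\<close>, \<open>U\<^sub>\<sigma>\<close> and \<open>b\<^sub>\<sigma>\<close> for the stratum with the listed chords.
\<close>

definition multiplicity_of :: "nat list \<Rightarrow> label \<Rightarrow> nat" where
  "multiplicity_of s l = length (filter (\<lambda>i. l \<in> set (circuit_labels i)) s)"

definition once_covered :: "nat list \<Rightarrow> label list" where
  "once_covered s = filter (\<lambda>l. multiplicity_of s l = 1) labels"

definition base :: "nat list \<Rightarrow> nat \<Rightarrow> nat" where
  "base s i = length (filter (\<lambda>l. l \<in> set (circuit_labels i)) (once_covered s))"

abbreviation index_list :: "nat list \<Rightarrow> bool" where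
  "index_list s \<equiv> distinct s \<and> set s \<subseteq> {1..7}"

lemma circuit_labels_in_labels: "i \<in> {1..7} \<Longrightarrow> set (circuit_labels i) \<subseteq> set labels"
  using circuit_labels_subset[of i] chord_in_labels[of i] tree_labels_subset by blast

lemma inj_chord: "inj_on chord {1..7}"
proof (rule inj_onI)
  fix i j assume "i \<in> {1..7}" "j \<in> {1..7}" "chord i = chord j"
  then have "Chord i = Chord j"
    by (intro inj_onD[OF inj_edge] chord_in_labels)
  then show "i = j"
    by simp
qed

lemma edge_in_circuit_labels:
  "i \<in> {1..7} \<Longrightarrow> l \<in> set labels \<Longrightarrow>
    edge l \<in> edge ` set (circuit_labels i) \<longleftrightarrow> l \<in> set (circuit_labels i)"
  using inj_on_image_mem_iff[OF inj_edge] circuit_labels_in_labels by blast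

lemma mult_M4:
  assumes s: "index_list s" and l: "l \<in> set labels"
  shows "mult M4 G4_B0 (chords s) (edge l) = multiplicity_of s l"
proof -
  have "{e \<in> chords s. edge l \<in> fund_circuit M4 G4_B0 e} =
      chord ` set (filter (\<lambda>i. l \<in> set (circuit_labels i)) s)" (is "_ = _ ` ?S")
    using s l fund_circuit_M4 edge_in_circuit_labels unfolding chords_def by auto
  moreover have "inj_on chord ?S"
    using inj_chord by (rule inj_on_subset) (use s in auto)
  ultimately show ?thesis
    using s by (simp add: mult_def multiplicity_of_def card_image distinct_card[symmetric])
qed

lemma U_M4: "index_list s \<Longrightarrow> U_set M4 G4_B0 (chords s) = edge ` set (once_covered s)"
  unfolding U_set_def ground_M4 once_covered_def by (auto simp: mult_M4)

lemma distinct_labels: "distinct labels"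
  by (simp add: labels_def tree_labels_def)

lemma baseline_M4:
  assumes s: "index_list s" and i: "i \<in> set s"
  shows "baseline M4 G4_B0 (chords s) (chord i) = base s i"
proof -
  have i7: "i \<in> {1..7}" using s i by blast
  have chord: "chord i \<in> chords s" using i by (auto simp: chords_def)
  have "edge ` set (circuit_labels i) \<inter> edge ` set (once_covered s)
      = edge ` set (filter (\<lambda>l. l \<in> set (circuit_labels i)) (once_covered s))" (is "_ = _ ` ?S")
    using edge_in_circuit_labels[OF i7] by (auto simp: once_covered_def)
  moreover have "inj_on edge ?S"
    using inj_edge by (rule inj_on_subset) (auto simp: once_covered_def)
  moreover have "distinct (once_covered s)"
    by (simp add: once_covered_def distinct_labels)
  ultimately show ?thesis
    using s chord by (simp add: baseline_def U_M4 fund_circuit_M4[OF i7] base_def card_image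
        distinct_card[symmetric] del: edge.simps)
qed

abbreviation full :: "nat list" where
  "full \<equiv> [1, 2, 3, 4, 5, 6, 7]"

lemma R_chords: "G4_R = chords full"
  by (simp add: R_edge chords_def)

lemma set_full: "set full = {1..7}"
  by auto

lemma index_full: "index_list full"
  by (intro conjI) simp_all

lemma chords_subset_R: "index_list s \<Longrightarrow> chords s \<subseteq> G4_R"
  unfolding R_chords chords_def set_full by (rule image_mono) (rule conjunct2)

lemma stratum_chords:
  assumes "index_list s" "s \<noteq> []"
  shows "stratum M4 G4_B0 (chords s)"
  unfolding stratum_def ground_minus_G4_B0
  using assms(2) chords_subset_R[OF assms(1)] by (simp add: chords_def)

text \<open>
  Since the baseline of \<open>R\<close> plus \<open>m\<close> may fire only dead strata, a live one must have some
  chord at which its own baseline is too large.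
\<close>

lemma live_not_fired:
  assumes X: "is_fibre M4 G4_B0 F G4_R X" "m \<in> X"
    and s: "index_list s" "s \<noteq> []" "length s < 7"
    and live: "\<not> forest (edge ` set (once_covered s))"
    and fire: "\<And>i. i \<in> set s \<Longrightarrow> base s i \<le> base full i + m (chord i)"
  shows False
proof -
  note full = index_full
  have sf: "set s \<subseteq> set full" using s(1) unfolding set_full by blast
  have "card (chords s) \<le> length s"
    unfolding chords_def by (metis List.card_set length_remdups_leq card_image_le List.finite_set le_trans)
  moreover have "card G4_R = 7"
    by (rule card_G4)
  ultimately have "chords s \<noteq> G4_R"
    using s(3) by auto
  then have sub: "chords s \<subset> G4_R"
    using chords_subset_R[OF s(1)] by blast
  have "can_fire M4 G4_B0 (chords s) (\<lambda>e. baseline M4 G4_B0 G4_R e + m e)"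
    unfolding can_fire_def
  proof
    fix e assume "e \<in> chords s"
    then obtain i where i: "i \<in> set s" "e = chord i"
      by (auto simp: chords_def)
    show "baseline M4 G4_B0 (chords s) e \<le> baseline M4 G4_B0 G4_R e + m e"
      using fire[OF i(1)] baseline_M4[OF s(1) i(1)] baseline_M4[OF full subsetD[OF sf i(1)]]
      unfolding i(2) R_chords by simp
  qed
  then have "dead M4 G4_B0 (chords s)"
    using X sub stratum_chords[OF s(1,2)] unfolding is_fibre_def by blast
  then show False
    using live unfolding dead_def U_M4[OF s(1)] indep_M4 by blast
qed

section \<open>The dead node of the full stratum\<close>

text \<open>
  The labels of the edges outside \<open>U\<^sub>R\<close>, that is, of the ground set of the dead node.
\<close>

definition node_labels :: "label list" where
  "node_labels = [Root 1, Root 2, Root 3, Stub 1, Stub 2, Stub 3, Stub 4, Stub 5, Stub 6]"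

definition node_bases :: "label set set" where
  "node_bases = {{Root 1, Root 3}, {Root 2, Root 3}, {Root 1, Stub 2}, {Root 1, Stub 5},
     {Root 2, Stub 2}, {Root 2, Stub 5}, {Root 3, Stub 2}, {Root 3, Stub 5}}"

lemma once_covered_full:
  "once_covered full = [Stub 0, Stub 7, Chord 1, Chord 2, Chord 3, Chord 4, Chord 5, Chord 6, Chord 7]"
  by (simp add: once_covered_def multiplicity_of_def labels_def tree_labels_def circuit_labels_def hub_def)

text \<open>
  The edges are ordered and oriented so that, read from the right, each one adds its second
  vertex as a new leaf; this is the form in which \<open>forest_insert_leaf\<close> applies repeatedly.
\<close>

lemma U_full:
  "edge ` set (once_covered full) = {{V 7, Hub 2}, {V 6, V 7}, {V 5, V 6}, {V 4, V 5}, {V 3, V 4},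
     {V 2, V 3}, {V 1, V 2}, {V 0, V 1}, {Hub 1, V 0}}"
  unfolding once_covered_full by (simp add: insert_commute)

lemma dead_R: "dead M4 G4_B0 G4_R"
proof -
  have "forest (edge ` set (once_covered full))"
    unfolding U_full by (intro forest_insert_leaf forest_empty) simp_all
  moreover have "set (once_covered full) \<subseteq> set labels"
    by (simp add: once_covered_def)
  ultimately show ?thesis
    using stratum_chords[OF index_full] unfolding dead_def R_chords U_M4[OF index_full] indep_M4
    by blast
qed

lemma A_full: "A_set M4 G4_B0 G4_R = ground M4"
proof -
  have "\<forall>l\<in>set labels. 1 \<le> multiplicity_of full l"
    by (simp add: multiplicity_of_def labels_def tree_labels_def circuit_labels_def hub_def)
  then have "\<forall>l\<in>set labels. 1 \<le> mult M4 G4_B0 (chords full) (edge l)"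
    using mult_M4[OF index_full] by metis
  then show ?thesis
    unfolding A_set_def R_chords ground_M4 by blast
qed

abbreviation K4 :: "vertex set matroid" where
  "K4 \<equiv> dead_node M4 G4_B0 G4_R"

lemma restriction_M4: "restriction M4 (ground M4) = M4"
  by (auto simp: restriction_def graphic_matroid_def)

lemma K4_eq: "K4 = contraction M4 (edge ` set (once_covered full))"
  unfolding dead_node_def A_full restriction_M4 by (simp only: R_chords U_M4[OF index_full])

lemma ground_K4: "ground K4 = edge ` set node_labels"
proof -
  have "set labels - set (once_covered full) = set node_labels"
    unfolding once_covered_full by (auto simp: labels_def tree_labels_def node_labels_def)
  moreover have "set (once_covered full) \<subseteq> set labels"
    by (simp add: once_covered_def)
  ultimately show ?thesis
    using inj_on_image_set_diff[OF inj_edge, of "set labels" "set (once_covered full)"]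
    unfolding K4_eq contraction_def ground_M4 by (metis Diff_subset matroid.select_convs(1))
qed

lemma indep_K4:
  assumes "L \<subseteq> set node_labels"
  shows "indep K4 (edge ` L) \<longleftrightarrow> forest (edge ` L \<union> edge ` set (once_covered full))"
proof -
  have "edge ` set (once_covered full) \<subseteq> ground M4" "indep M4 (edge ` set (once_covered full))"
    using dead_R unfolding dead_def R_chords U_M4[OF index_full] indep_M4 ground_M4 by blast+
  moreover have "edge ` L \<subseteq> ground M4 - edge ` set (once_covered full)"
    using assms ground_K4 unfolding K4_eq contraction_def by auto
  ultimately show ?thesis
    unfolding K4_eq by (subst indep_contraction_indep) (auto simp: indep_M4 ground_M4)
qed

lemma node_bases_forest:
  assumes "L \<in> node_bases"
  shows "forest (edge ` L \<union> edge ` set (once_covered full))"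
proof -
  have "forest (insert {Org, Hub 3} (insert {Hub 1, Org} (edge ` set (once_covered full))))"
    "forest (insert {Org, Hub 3} (insert {Hub 2, Org} (edge ` set (once_covered full))))"
    "forest (insert {Hub 1, Org} (insert {V 2, Hub 3} (edge ` set (once_covered full))))"
    "forest (insert {Hub 1, Org} (insert {V 5, Hub 3} (edge ` set (once_covered full))))"
    "forest (insert {Hub 2, Org} (insert {V 2, Hub 3} (edge ` set (once_covered full))))"
    "forest (insert {Hub 2, Org} (insert {V 5, Hub 3} (edge ` set (once_covered full))))"
    "forest (insert {Hub 3, Org} (insert {V 2, Hub 3} (edge ` set (once_covered full))))"
    "forest (insert {Hub 3, Org} (insert {V 5, Hub 3} (edge ` set (once_covered full))))"
    unfolding U_full by (intro forest_insert_leaf forest_empty; simp)+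
  then show ?thesis
    using assms unfolding node_bases_def by (elim insertE) (simp_all add: insert_commute)
qed

definition node_circuits :: "label set set" where
  "node_circuits = {{Stub 1}, {Stub 3}, {Stub 4}, {Stub 6}, {Root 1, Root 2}, {Stub 2, Stub 5},
     {Root 1, Root 3, Stub 2}, {Root 1, Root 3, Stub 5},
     {Root 2, Root 3, Stub 2}, {Root 2, Root 3, Stub 5}}"

lemma node_circuits_cycle:
  assumes "L \<in> node_circuits"
  shows "\<not> forest (edge ` L \<union> edge ` set (once_covered full))"
proof -
  have "\<exists>p. 3 \<le> length p \<and> distinct p \<and>
      set (map2 (\<lambda>a b. {a, b}) p (rotate1 p)) \<subseteq> edge ` L \<union> edge ` set (once_covered full)"
    using assms unfolding node_circuits_def U_full
  proof (elim insertE, goal_cases)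
    case 1 then show ?case
      by (intro exI[of _ "[Hub 2, V 1, V 2, V 3, V 4, V 5, V 6, V 7]"])
        (simp add: doubleton_eq_iff)
  next
    case 2 then show ?case
      by (intro exI[of _ "[Hub 1, V 0, V 1, V 2, V 3]"]) (simp add: doubleton_eq_iff)
  next
    case 3 then show ?case
      by (intro exI[of _ "[Hub 2, V 4, V 5, V 6, V 7]"]) (simp add: doubleton_eq_iff)
  next
    case 4 then show ?case
      by (intro exI[of _ "[Hub 1, V 0, V 1, V 2, V 3, V 4, V 5, V 6]"])
        (simp add: doubleton_eq_iff)
  next
    case 5 then show ?case
      by (intro exI[of _ "[Org, Hub 1, V 0, V 1, V 2, V 3, V 4, V 5, V 6, V 7, Hub 2]"])
        (simp add: doubleton_eq_iff)
  next
    case 6 then show ?case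
      by (intro exI[of _ "[Hub 3, V 2, V 3, V 4, V 5]"]) (simp add: doubleton_eq_iff)
  next
    case 7 then show ?case
      by (intro exI[of _ "[Org, Hub 1, V 0, V 1, V 2, Hub 3]"]) (simp add: doubleton_eq_iff)
  next
    case 8 then show ?case
      by (intro exI[of _ "[Org, Hub 1, V 0, V 1, V 2, V 3, V 4, V 5, Hub 3]"])
        (simp add: doubleton_eq_iff)
  next
    case 9 then show ?case
      by (intro exI[of _ "[Org, Hub 2, V 7, V 6, V 5, V 4, V 3, V 2, Hub 3]"])
        (simp add: doubleton_eq_iff)
  next
    case 10 then show ?case
      by (intro exI[of _ "[Org, Hub 2, V 7, V 6, V 5, Hub 3]"]) (simp add: doubleton_eq_iff)
  qed simp
  then show ?thesis
    using not_forestI by blast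
qed

text \<open>
  The bases and circuits listed are a complete certificate: a set of edges that avoids the
  loops, contains at most one edge of each parallel class and does not contain a triangle lies
  in one of the eight bases.
\<close>

lemma circuit_or_in_basis:
  assumes L: "L \<subseteq> set node_labels" and c: "\<And>C. C \<in> node_circuits \<Longrightarrow> \<not> C \<subseteq> L"
  shows "\<exists>P\<in>node_bases. L \<subseteq> P"
proof -
  have "L \<subseteq> {Root 1, Root 2, Root 3, Stub 2, Stub 5}"
    using L c[of "{Stub 1}"] c[of "{Stub 3}"] c[of "{Stub 4}"] c[of "{Stub 6}"]
    by (auto simp: node_circuits_def node_labels_def)
  moreover have "\<not> (Root 1 \<in> L \<and> Root 2 \<in> L)" "\<not> (Stub 2 \<in> L \<and> Stub 5 \<in> L)"
    "\<not> (Root 1 \<in> L \<and> Root 3 \<in> L \<and> Stub 2 \<in> L)" "\<not> (Root 1 \<in> L \<and> Root 3 \<in> L \<and> Stub 5 \<in> L)"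
    "\<not> (Root 2 \<in> L \<and> Root 3 \<in> L \<and> Stub 2 \<in> L)" "\<not> (Root 2 \<in> L \<and> Root 3 \<in> L \<and> Stub 5 \<in> L)"
    using c[of "{Root 1, Root 2}"] c[of "{Stub 2, Stub 5}"]
      c[of "{Root 1, Root 3, Stub 2}"] c[of "{Root 1, Root 3, Stub 5}"]
      c[of "{Root 2, Root 3, Stub 2}"] c[of "{Root 2, Root 3, Stub 5}"]
    by (simp_all add: node_circuits_def)
  ultimately show ?thesis
    unfolding node_bases_def bex_simps
    by (cases "Root 1 \<in> L"; cases "Root 2 \<in> L"; cases "Root 3 \<in> L"; cases "Stub 2 \<in> L";
        cases "Stub 5 \<in> L"; simp) blast+
qed

definition node_indep :: "label set set" where
  "node_indep = {{}, {Root 1}, {Root 2}, {Root 3}, {Stub 2}, {Stub 5}} \<union> node_bases"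

lemma node_indep_iff: "L \<in> node_indep \<longleftrightarrow> (\<exists>P\<in>node_bases. L \<subseteq> P)"
proof -
  have sub: "L \<subseteq> {a, b} \<longleftrightarrow> L = {} \<or> L = {a} \<or> L = {b} \<or> L = {a, b}" for a b
    by (cases "a \<in> L"; cases "b \<in> L") auto
  show ?thesis
    unfolding node_indep_def node_bases_def bex_simps sub Un_iff insert_iff empty_iff
    by (rule iffI; elim disjE; simp)
qed

lemma indep_sets_K4: "{I. I \<subseteq> ground K4 \<and> indep K4 I} = (`) edge ` node_indep"
proof (intro equalityI subsetI)
  fix I assume "I \<in> {I. I \<subseteq> ground K4 \<and> indep K4 I}"
  then obtain L where L: "L \<subseteq> set node_labels" "I = edge ` L" "indep K4 (edge ` L)"
    unfolding ground_K4 by (auto elim!: subset_imageE)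
  have "\<not> C \<subseteq> L" if "C \<in> node_circuits" for C
    using node_circuits_cycle[OF that] L(3) unfolding indep_K4[OF L(1)]
    by (meson Un_mono forest_subset image_mono order_refl)
  then have "L \<in> node_indep"
    using circuit_or_in_basis[OF L(1)] unfolding node_indep_iff by blast
  with L(2) show "I \<in> (`) edge ` node_indep"
    by blast
next
  fix I assume "I \<in> (`) edge ` node_indep"
  then obtain L P where L: "I = edge ` L" "P \<in> node_bases" "L \<subseteq> P"
    using node_indep_iff by blast
  have "P \<subseteq> set node_labels"
    using L(2) unfolding node_bases_def node_labels_def by (elim insertE) simp_all
  then have L_sub: "L \<subseteq> set node_labels"
    using L(3) by blast
  have "forest (edge ` L \<union> edge ` set (once_covered full))"
    using node_bases_forest[OF L(2)] L(3) by (meson Un_mono forest_subset image_mono order_refl)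
  then show "I \<in> {I. I \<subseteq> ground K4 \<and> indep K4 I}"
    using L_sub indep_K4[OF L_sub] unfolding L(1) ground_K4 by blast
qed

lemma inj_node_indep: "inj_on ((`) edge) node_indep"
  "L \<in> node_indep \<Longrightarrow> card (edge ` L) = card L"
proof -
  have sub: "L \<subseteq> set labels" if "L \<in> node_indep" for L
    using that unfolding node_indep_def node_bases_def Un_iff
    by (elim disjE insertE) (simp_all add: labels_def tree_labels_def)
  show "inj_on ((`) edge) node_indep"
    using inj_on_image_eq_iff[OF inj_edge] sub by (auto simp: inj_on_def)
  show "card (edge ` L) = card L" if "L \<in> node_indep"
    using inj_on_subset[OF inj_edge sub[OF that]] by (rule card_image)
qed

lemma rank_K4: "matroid_rank K4 = 2"
proof -
  have "{card I |I. I \<subseteq> ground K4 \<and> indep K4 I} = card ` (`) edge ` node_indep"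
    unfolding indep_sets_K4[symmetric] by blast
  also have "\<dots> = card ` node_indep"
    unfolding image_image by (rule image_cong) (simp_all add: inj_node_indep(2))
  also have "\<dots> = {0, 1, 2}"
    by (auto simp: node_indep_def node_bases_def)
  finally show ?thesis
    by (simp add: matroid_rank_def rank_of_def)
qed

lemma tutte_K4: "tutte K4 x 1 = (x - 1)^2 + 5 * (x - 1) + 8"
proof -
  have "tutte K4 x 1 = (\<Sum>I\<in>(`) edge ` node_indep. (x - 1) ^ (2 - card I))"
  proof (subst tutte_at_y_1)
    show "finite (ground K4)"
      by (simp add: ground_K4)
    have "{} \<in> (`) edge ` node_indep"
      by (simp add: node_indep_def)
    then show "indep K4 {}"
      unfolding indep_sets_K4[symmetric] by blast
  qed (simp only: indep_sets_K4 rank_K4)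
  also have "\<dots> = (\<Sum>L\<in>node_indep. (x - 1) ^ (2 - card L))"
    by (simp add: sum.reindex[OF inj_node_indep(1)] inj_node_indep(2) cong: sum.cong)
  also have "\<dots> = (x - 1)^2 + 5 * (x - 1) + 8"
    by (simp add: node_indep_def node_bases_def doubleton_eq_iff)
  finally show ?thesis .
qed

lemma h_vector_K4: "h_vector K4 = [1, 3, 4]"
proof -
  have "tutte K4 [:0, 1:] 1 = [:4, 3, 1 :: int:]"
    unfolding tutte_K4 by (simp add: power2_eq_square one_pCons numeral_poly)
  then show ?thesis
    unfolding h_vector_def rank_K4 by (simp add: numeral_2_eq_2)
qed

section \<open>Live strata that obstruct the full stratum\<close>

lemma live_cycle_not_fired:
  assumes X: "is_fibre M4 G4_B0 F G4_R X" "m \<in> X"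
    and s: "index_list s" "s \<noteq> []" "length s < 7"
    and p: "3 \<le> length p" "distinct p"
      "set (map2 (\<lambda>a b. {a, b}) p (rotate1 p)) \<subseteq> edge ` set (once_covered s)"
    and fire: "\<forall>i\<in>set s. base s i \<le> base full i + m (chord i)"
  shows False
  using live_not_fired[OF X s not_forestI[OF p]] fire by blast

text \<open>
  Each live stratum is witnessed by a cycle in its once-covered edges. Such a cycle closes up
  a stretch of the path through one hub, or two stretches through hubs 1 and 2. The baseline
  of the stratum exceeds that of \<open>R\<close> by one at exactly the chords whose variables are
  excluded.
\<close>

lemma fibre_vanishing:
  assumes X: "is_fibre M4 G4_B0 F G4_R X" "m \<in> X"
  shows "m (chord 2) = 0" "m (chord 3) = 0" "m (chord 5) = 0" "m (chord 6) = 0"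
    "m (chord 1) = 0 \<or> m (chord 4) = 0" "m (chord 4) = 0 \<or> m (chord 7) = 0"
    "m (chord 1) = 0 \<or> m (chord 7) = 0"
proof -
  note ev = base_def once_covered_def multiplicity_of_def labels_def tree_labels_def
    circuit_labels_def hub_def
  note live = live_cycle_not_fired[OF X]
  show "m (chord 2) = 0"
  proof (rule ccontr)
    assume "m (chord 2) \<noteq> 0"
    then show False
      by (intro live[where s = "[2, 3, 4, 5, 6, 7]"
            and p = "[Hub 2, V 1, V 2, V 3, V 4, V 5, V 6, V 7]"])
        (simp_all add: ev doubleton_eq_iff)
  qed
  show "m (chord 3) = 0"
  proof (rule ccontr)
    assume "m (chord 3) \<noteq> 0"
    then show False
      by (intro live[where s = "[1, 2, 3]" and p = "[Hub 1, V 0, V 1, V 2, V 3]"])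
        (simp_all add: ev doubleton_eq_iff)
  qed
  show "m (chord 5) = 0"
  proof (rule ccontr)
    assume "m (chord 5) \<noteq> 0"
    then show False
      by (intro live[where s = "[5, 6, 7]" and p = "[Hub 2, V 4, V 5, V 6, V 7]"])
        (simp_all add: ev doubleton_eq_iff)
  qed
  show "m (chord 6) = 0"
  proof (rule ccontr)
    assume "m (chord 6) \<noteq> 0"
    then show False
      by (intro live[where s = "[1, 2, 3, 4, 5, 6]"
            and p = "[Hub 1, V 0, V 1, V 2, V 3, V 4, V 5, V 6]"])
        (simp_all add: ev doubleton_eq_iff)
  qed
  show "m (chord 1) = 0 \<or> m (chord 4) = 0"
  proof (rule ccontr)
    assume "\<not> (m (chord 1) = 0 \<or> m (chord 4) = 0)"
    then show False
      by (intro live[where s = "[1, 4, 5, 6, 7]"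
            and p = "[Hub 1, V 0, V 1, Hub 2, V 7, V 6, V 5, V 4, V 3]"])
        (simp_all add: ev doubleton_eq_iff)
  qed
  show "m (chord 4) = 0 \<or> m (chord 7) = 0"
  proof (rule ccontr)
    assume "\<not> (m (chord 4) = 0 \<or> m (chord 7) = 0)"
    then show False
      by (intro live[where s = "[1, 2, 3, 4, 7]"
            and p = "[Hub 1, V 0, V 1, V 2, V 3, V 4, Hub 2, V 7, V 6]"])
        (simp_all add: ev doubleton_eq_iff)
  qed
  show "m (chord 1) = 0 \<or> m (chord 7) = 0"
  proof (rule ccontr)
    assume "\<not> (m (chord 1) = 0 \<or> m (chord 7) = 0)"
    then show False
      by (intro live[where s = "[1, 7]" and p = "[Hub 1, V 0, V 1, Hub 2, V 7, V 6]"])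
        (simp_all add: ev doubleton_eq_iff)
  qed
qed

lemma fibre_quadratic:
  assumes X: "is_fibre M4 G4_B0 F G4_R X" "m \<in> X" and deg: "monom_degree m = 2"
  shows "\<exists>i\<in>{1, 4, 7}. m = (\<lambda>_. 0)(chord i := 2)"
proof -
  note van = fibre_vanishing[OF X]
  have "m \<in> vectors_on G4_R"
    using X unfolding is_fibre_def by blast
  then have R: "e \<in> G4_R" if "m e \<noteq> 0" for e
    using that unfolding vectors_on_def by auto
  have supp: "{e. m e \<noteq> 0} \<subseteq> {chord 1, chord 4, chord 7}"
  proof
    fix e assume "e \<in> {e. m e \<noteq> 0}"
    then obtain i where i: "i \<in> set full" "e = chord i" "m (chord i) \<noteq> 0"
      using R unfolding R_edge by blast
    then have "i \<in> {1, 4, 7}"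
      using van(1-4) by (auto simp del: edge.simps)
    with i(2) show "e \<in> {chord 1, chord 4, chord 7}"
      by blast
  qed
  have "{e. m e \<noteq> 0} \<noteq> {}"
    using deg unfolding monom_degree_def by (metis sum.empty zero_neq_numeral)
  then obtain i where i: "i \<in> {1, 4, 7}" "m (chord i) \<noteq> 0"
    using supp by blast
  have "{e. m e \<noteq> 0} = {chord i}"
    using supp i van(5-7) by (auto simp del: edge.simps)
  with deg have "m (chord i) = 2" "\<And>e. e \<noteq> chord i \<Longrightarrow> m e = 0"
    by (auto simp: monom_degree_def simp del: edge.simps)
  then have "m = (\<lambda>_. 0)(chord i := 2)"
    by (auto simp: fun_eq_iff simp del: edge.simps)
  with i(1) show ?thesis
    by blast
qed

lemma no_fibre_R: "\<not> is_fibre M4 G4_B0 F G4_R X"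
proof
  assume X: "is_fibre M4 G4_B0 F G4_R X"
  have "int (card {a \<in> X. monom_degree a = 2}) = nth_default 0 [1, 3, 4] 2"
    using X unfolding is_fibre_def has_degree_sequence_def h_vector_K4 by blast
  then have "card {a \<in> X. monom_degree a = 2} = 4"
    by (simp add: nth_default_def)
  moreover have "{a \<in> X. monom_degree a = 2} \<subseteq> (\<lambda>i. (\<lambda>_. 0)(chord i := 2)) ` {1, 4, 7}"
    using fibre_quadratic[OF X] by blast
  then have "card {a \<in> X. monom_degree a = 2} \<le> card {1, 4, 7 :: nat}"
    by (meson card_image_le card_mono finite.emptyI finite_imageI finite_insert le_trans)
  ultimately show False
    by simp
qed

theorem mainTheorem12:
  shows "dead (graphic_matroid G4) G4_B0 G4_R
    \<and> h_vector (dead_node (graphic_matroid G4) G4_B0 G4_R) = [1, 3, 4]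
    \<and> (\<forall>F. fibres_strictly_inside (graphic_matroid G4) G4_B0 F G4_R
          \<longrightarrow> obstructed (graphic_matroid G4) G4_B0 F G4_R)
    \<and> \<not> (\<exists>F. fibre_system (graphic_matroid G4) G4_B0 F)"
  using dead_R h_vector_K4 no_fibre_R unfolding obstructed_def fibre_system_def by blast

end
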